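(* Let $m\in\mathbb{N}=\{1,2,\dots\}$ and let $E\subset\mathbb{R}^m$ be a set of zero relative Lebesgue density in $\mathbb{R}^m$, i.e. ${\sf L}_m(E)=0$. If a convex or harmonic function of finite order on $\mathbb{R}^m$ is bounded above on $\mathbb{R}^m\setminus E$, then it is constant.
   Context: $\lambda$ is Lebesgue measure on $\mathbb{R}^m$, $|\cdot|$ is the Euclidean norm, and $B(r)$ is the ball of radius $r$ centred at $0$. The relative Lebesgue density of a Lebesgue measurable set $E\subset\mathbb{R}^m$ is ${\sf L}_m(E):=\lim_{r\to+\infty}\lambda(E\cap B(r))/r^m$, if the limit exists; ${\sf L}_m(E)=0$ means that $E$ is Lebesgue measurable and this limit exists and equals $0$. The order of a function $M$ on $\mathbb{R}^m$ is $\limsup_{|x|\to\infty}\dfrac{\ln(1+M^+(x))}{\ln|x|}\in[0,+\infty]$, where $M^+:=\max\{0,M\}$; $M$ has finite order if this quantity is $<+\infty$. Convex and harmonic functions are real-valued. *)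

theory Defs
  imports "HOL-Analysis.Analysis"
begin

definition has_relative_density :: "'a::euclidean_space set \<Rightarrow> real \<Rightarrow> bool" where
  "has_relative_density E l \<longleftrightarrow>
     E \<in> sets lebesgue \<and>
     ((\<lambda>r::real. measure lebesgue (E \<inter> ball 0 r) / r ^ DIM('a)) \<longlongrightarrow> l) at_top"

definition function_order :: "('a::euclidean_space \<Rightarrow> real) \<Rightarrow> ereal" where
  "function_order M =
     Limsup at_infinity (\<lambda>x. ereal (ln (1 + max 0 (M x)) / ln (norm x)))"

definition finite_order :: "('a::euclidean_space \<Rightarrow> real) \<Rightarrow> bool" where
  "finite_order M \<longleftrightarrow> function_order M < \<infinity>"

(* This is the partial derivative along i only where f is differentiable;
   C1_function and C2_function below guarantee differentiability. *)
definition partial_derivative ::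
  "'a::euclidean_space \<Rightarrow> ('a \<Rightarrow> real) \<Rightarrow> 'a \<Rightarrow> real" where
  "partial_derivative i f x = frechet_derivative f (at x) i"

definition C1_function :: "('a::euclidean_space \<Rightarrow> real) \<Rightarrow> bool" where
  "C1_function f \<longleftrightarrow>
     (\<forall>x. f differentiable (at x)) \<and>
     (\<forall>i\<in>Basis. continuous_on UNIV (partial_derivative i f))"

definition C2_function :: "('a::euclidean_space \<Rightarrow> real) \<Rightarrow> bool" where
  "C2_function f \<longleftrightarrow>
     C1_function f \<and> (\<forall>i\<in>Basis. C1_function (partial_derivative i f))"

definition laplacian :: "('a::euclidean_space \<Rightarrow> real) \<Rightarrow> 'a \<Rightarrow> real" where
  "laplacian f x = (\<Sum>i\<in>Basis. partial_derivative i (partial_derivative i f) x)"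

definition harmonic_function :: "('a::euclidean_space \<Rightarrow> real) \<Rightarrow> bool" where
  "harmonic_function f \<longleftrightarrow> C2_function f \<and> (\<forall>x. laplacian f x = 0)"

end

theory Submission
  imports Defs
begin

text \<open>Convex and harmonic functions are dominated by their averages against the rescaled kernel
  \<open>max 0 (1 - |y|\<^sup>2)\<close>. If \<open>f \<le> C\<close> off \<open>E\<close>, averaging at scale \<open>r\<close> shows that the maximum of \<open>f - C\<close>
  on \<open>B(r)\<close> is at most a small multiple \<open>\<epsilon>\<close> of that on \<open>B(2r)\<close>, since \<open>E\<close> has density zero. Iterating
  \<open>k\<close> times gains \<open>\<epsilon>\<^sup>k\<close>, while the finite order only loses a factor \<open>2\<^bsup>kp\<^esup>\<close>; hence \<open>f \<le> C\<close>
  everywhere, and a Liouville theorem applies.\<close>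

section \<open>Integrals of compactly supported functions\<close>

text \<open>Bounded support reduces the substitution to one on a box, outside of which everything
  vanishes. It is applied below to translations, to the reflection in the origin and to
  dilations.\<close>

lemma has_integral_affinity_UNIV:
  fixes f :: "'a::euclidean_space \<Rightarrow> real"
  assumes "(f has_integral i) UNIV" and "bounded {x. f x \<noteq> 0}" and "r \<noteq> 0"
  shows "((\<lambda>x. f (c + r *\<^sub>R x)) has_integral i / \<bar>r\<bar> ^ DIM('a)) UNIV"
proof -
  obtain a where a: "{x. f x \<noteq> 0} \<subseteq> cbox (-a) a"
    using bounded_subset_cbox_symmetric[OF assms(2)] by blast
  have f0: "f x = 0" if "x \<notin> cbox (-a) a" for x
    using a that by blast
  have "f = (\<lambda>x. if x \<in> cbox (-a) a then f x else 0)"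
    using f0 by auto
  then have "(f has_integral i) (cbox (-a) a)"
    using assms(1) has_integral_restrict_UNIV[of "cbox (-a) a" f i] by simp
  from has_integral_affinity[OF this assms(3), of c]
  have "((\<lambda>x. f (r *\<^sub>R x + c)) has_integral (1 / \<bar>r\<bar> ^ DIM('a)) *\<^sub>R i)
          ((\<lambda>x. (1 / r) *\<^sub>R x + - ((1 / r) *\<^sub>R c)) ` cbox (-a) a)" .
  then have "((\<lambda>x. f (r *\<^sub>R x + c)) has_integral (1 / \<bar>r\<bar> ^ DIM('a)) *\<^sub>R i) UNIV"
  proof (rule has_integral_on_superset)
    fix x assume x: "x \<notin> (\<lambda>x. (1 / r) *\<^sub>R x + - ((1 / r) *\<^sub>R c)) ` cbox (-a) a"
    have "x = (1 / r) *\<^sub>R (r *\<^sub>R x + c) + - ((1 / r) *\<^sub>R c)"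
      using assms(3) by (simp add: scaleR_right_distrib)
    then have "r *\<^sub>R x + c \<notin> cbox (-a) a"
      using x by blast
    then show "f (r *\<^sub>R x + c) = 0"
      by (rule f0)
  qed simp
  then show ?thesis
    by (simp add: add.commute)
qed

lemma integrable_UNIV_compact_support:
  fixes f :: "'a::euclidean_space \<Rightarrow> real"
  assumes "continuous_on UNIV f" and "bounded {x. f x \<noteq> 0}"
  shows "f integrable_on UNIV"
proof -
  obtain a where a: "{x. f x \<noteq> 0} \<subseteq> cbox (-a) a"
    using bounded_subset_cbox_symmetric[OF assms(2)] by blast
  have "f integrable_on cbox (-a) a"
    using assms(1) integrable_continuous continuous_on_subset by blast
  then show ?thesis
    by (rule integrable_on_superset) (use a in auto)
qed

lemma integral_UNIV_eq_integral_cbox: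
  fixes f :: "'a::euclidean_space \<Rightarrow> real"
  assumes "\<And>x. x \<notin> S \<Longrightarrow> f x = 0"
  shows "integral UNIV f = integral S f"
proof -
  have "f = (\<lambda>x. if x \<in> S then f x else 0)"
    using assms by auto
  then show ?thesis
    using integral_restrict_UNIV[of S f] by simp
qed

text \<open>For \<open>t\<close> in a bounded interval all integrands live in one ball, so the
  Leibniz rule on a fixed box applies. Restricting \<open>t\<close> matters for translates, whose
  supports drift away as \<open>t\<close> grows.\<close>

lemma has_real_derivative_integral_UNIV:
  fixes h :: "real \<Rightarrow> 'a::euclidean_space \<Rightarrow> real"
  assumes deriv: "\<And>t y. \<bar>t\<bar> \<le> A \<Longrightarrow> ((\<lambda>t. h t y) has_real_derivative h' t y) (at t)"
    and cont: "\<And>t. continuous_on UNIV (h t)"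
    and cont': "continuous_on UNIV (\<lambda>(t, y). h' t y)"
    and supp: "\<And>t y. \<bar>t\<bar> \<le> A \<Longrightarrow> norm y > B \<Longrightarrow> h t y = 0"
    and supp': "\<And>t y. \<bar>t\<bar> \<le> A \<Longrightarrow> norm y > B \<Longrightarrow> h' t y = 0"
    and t: "\<bar>t\<bar> < A"
  shows "((\<lambda>t. integral UNIV (h t)) has_real_derivative integral UNIV (h' t)) (at t)"
proof -
  obtain a :: 'a where a: "cball 0 B \<subseteq> cbox (-a) a"
    using bounded_subset_cbox_symmetric[OF bounded_cball] by blast
  have out: "norm y > B" if "y \<notin> cbox (-a) a" for y
    using a that by (force simp: subset_iff)
  have "((\<lambda>t. integral (cbox (-a) a) (h t)) has_real_derivative integral (cbox (-a) a) (h' t))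
          (at t within {-A<..<A})"
  proof (rule leibniz_rule_field_derivative)
    show "((\<lambda>t. h t y) has_real_derivative h' s y) (at s within {-A<..<A})"
      if "s \<in> {-A<..<A}" for s y
      using deriv[of s y] that by (auto intro: has_field_derivative_at_within)
    show "h s integrable_on cbox (-a) a" for s
      using cont integrable_continuous continuous_on_subset by blast
    show "continuous_on ({-A<..<A} \<times> cbox (-a) a) (\<lambda>(t, y). h' t y)"
      using cont' continuous_on_subset by blast
  qed (use t in auto)
  then have "((\<lambda>t. integral (cbox (-a) a) (h t)) has_real_derivative integral (cbox (-a) a) (h' t)) (at t)"
    using t by (subst (asm) at_within_open) auto
  then have "((\<lambda>t. integral UNIV (h t)) has_real_derivative integral (cbox (-a) a) (h' t)) (at t)"
  proof (rule has_field_derivative_transform_within_open[of _ _ _ "{-A<..<A}"])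
    show "integral (cbox (-a) a) (h s) = integral UNIV (h s)" if "s \<in> {-A<..<A}" for s
      by (rule integral_UNIV_eq_integral_cbox[symmetric]) (use supp out that in auto)
  qed (use t in auto)
  moreover have "integral UNIV (h' t) = integral (cbox (-a) a) (h' t)"
    by (rule integral_UNIV_eq_integral_cbox) (use supp' out t in auto)
  ultimately show ?thesis
    by simp
qed

text \<open>Since translates of \<open>g\<close> all have the same integral, differentiating under the integral sign
  gives the integration by parts that is needed, without Fubini.\<close>

lemma integral_directional_derivative_eq_0:
  fixes g g' :: "'a::euclidean_space \<Rightarrow> real"
  assumes deriv: "\<And>y t. ((\<lambda>t. g (y + t *\<^sub>R e)) has_real_derivative g' (y + t *\<^sub>R e)) (at t)"
    and cont: "continuous_on UNIV g" and cont': "continuous_on UNIV g'"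
    and supp: "\<And>y. norm y > 1 \<Longrightarrow> g y = 0" and supp': "\<And>y. norm y > 1 \<Longrightarrow> g' y = 0"
  shows "integral UNIV g' = 0"
proof -
  have bdd: "bounded {y. g y \<noteq> 0}"
    by (rule bounded_subset[OF bounded_cball[of 0 1]]) (use supp in force)
  \<comment> \<open>A translation by at most \<open>norm e\<close> keeps the support inside the ball
    of radius \<open>1 + norm e\<close>, which serves as the common \<open>B\<close>.\<close>
  have far: "norm (y + t *\<^sub>R e) > 1" if "\<bar>t\<bar> \<le> 1" "norm y > 1 + norm e" for y t
  proof -
    have "norm (t *\<^sub>R e) \<le> norm e"
      using that by (simp add: mult_left_le_one_le)
    then show ?thesis
      using norm_diff_ineq[of y "t *\<^sub>R e"] that by simp
  qed
  have "((\<lambda>t. integral UNIV (\<lambda>y. g (y + t *\<^sub>R e))) has_real_derivative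
          integral UNIV (\<lambda>y. g' (y + 0 *\<^sub>R e))) (at 0)"
  proof (rule has_real_derivative_integral_UNIV[where A = 1 and B = "1 + norm e"])
    show "continuous_on UNIV (\<lambda>y. g (y + t *\<^sub>R e))" for t
      by (rule continuous_on_compose2[OF cont]) (auto intro!: continuous_intros)
    show "continuous_on UNIV (\<lambda>(t, y). g' (y + t *\<^sub>R e))"
      unfolding split_beta
      by (rule continuous_on_compose2[OF cont']) (auto intro!: continuous_intros)
  qed (use deriv far supp supp' in auto)
  moreover have "integral UNIV (\<lambda>y. g (y + t *\<^sub>R e)) = integral UNIV g" for t
    using has_integral_affinity_UNIV[OF integrable_integral[OF integrable_UNIV_compact_support[OF cont bdd]] bdd,
        of 1 "t *\<^sub>R e"]
    by (simp add: add.commute integral_unique)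
  ultimately have "((\<lambda>t::real. integral UNIV g) has_real_derivative integral UNIV g') (at 0)"
    by simp
  then show ?thesis
    using DERIV_const DERIV_unique by blast
qed

section \<open>The kernel\<close>

text \<open>An unnormalised radial weight on the unit ball. It is continuous and even, its square is
  differentiable along lines with gradient \<open>-4 * bump y\<close> times \<open>y\<close>, and
  its dilates are truncated paraboloids that are easy to compare.\<close>

definition bump :: "'a::euclidean_space \<Rightarrow> real" where
  "bump y = max 0 (1 - y \<bullet> y)"

definition bump_mass :: "'a::euclidean_space itself \<Rightarrow> real" where
  "bump_mass _ = integral UNIV (bump :: 'a \<Rightarrow> real)"

lemma bump_nonneg: "bump y \<ge> 0"
  by (simp add: bump_def)

lemma bump_le_1: "bump y \<le> 1"
  by (simp add: bump_def)

lemma bump_eq_0: "norm y \<ge> 1 \<Longrightarrow> bump y = 0"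
  by (simp add: bump_def max_def dot_square_norm power_le_one_iff)

lemma continuous_on_bump [continuous_intros]:
  "continuous_on S g \<Longrightarrow> continuous_on S (\<lambda>x. bump (g x))"
  unfolding bump_def by (intro continuous_intros)

lemma bounded_support_mult_bump: "bounded {y. g y * bump y \<noteq> 0}"
  by (rule bounded_subset[OF bounded_cball[of 0 1]]) (use bump_eq_0 in force)

lemma integrable_mult_bump:
  "continuous_on UNIV g \<Longrightarrow> (\<lambda>y. g y * bump y) integrable_on UNIV"
  by (intro integrable_UNIV_compact_support bounded_support_mult_bump continuous_intros)

lemma continuous_on_affine_compose:
  fixes f :: "'a::real_normed_vector \<Rightarrow> real"
  assumes "continuous_on UNIV f"
  shows "continuous_on UNIV (\<lambda>y. f (x + r *\<^sub>R y))"
  by (rule continuous_on_compose2[OF assms]) (auto intro!: continuous_intros)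

lemma integrable_bump: "(bump :: 'a::euclidean_space \<Rightarrow> real) integrable_on UNIV"
  using integrable_mult_bump[of "\<lambda>_. 1"] by simp

text \<open>A nonnegative continuous function with zero integral over a box vanishes on the box,
  whereas \<open>bump\<close> equals 1 at the origin. The box used here contains the unit ball,
  hence the whole support.\<close>

lemma bump_mass_pos: "bump_mass TYPE('a::euclidean_space) > 0"
proof -
  have eq: "bump_mass TYPE('a) = integral (cbox (-One) One) (bump :: 'a \<Rightarrow> real)"
    unfolding bump_mass_def
  proof (rule integral_UNIV_eq_integral_cbox)
    fix x :: 'a assume "x \<notin> cbox (-One) One"
    then obtain i where i: "i \<in> Basis" "\<bar>x \<bullet> i\<bar> > 1"
      by (force simp: mem_box)
    then have "norm x \<ge> 1"
      using Basis_le_norm[OF i(1), of x] by simp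
    then show "bump x = 0"
      by (rule bump_eq_0)
  qed
  have "integral (cbox (-One) One) (bump :: 'a \<Rightarrow> real) \<noteq> 0"
  proof
    assume "integral (cbox (-One) One) (bump :: 'a \<Rightarrow> real) = 0"
    then have "\<forall>x\<in>cbox (-One) One. bump (x::'a) = 0"
      by (subst (asm) integral_cbox_eq_0_iff)
        (auto intro!: continuous_intros bump_nonneg simp: box_ne_empty)
    then have "bump (0::'a) = 0"
      by (auto simp: mem_box)
    then show False
      by (simp add: bump_def)
  qed
  moreover have "integral (cbox (-One) One) (bump :: 'a \<Rightarrow> real) \<ge> 0"
    by (rule integral_nonneg) (auto intro: integrable_on_subcbox[OF integrable_bump] bump_nonneg)
  ultimately show ?thesis
    using eq by simp
qed

text \<open>Squaring removes the corner at 0, where the difference quotient is at most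
  \<open>\<bar>h\<bar>\<close>; elsewhere the function is locally a square or zero.\<close>

lemma has_real_derivative_max_square:
  "((\<lambda>t. (max 0 t)\<^sup>2) has_real_derivative 2 * max 0 t) (at (t::real))"
proof (cases "t = 0")
  case True
  have "((\<lambda>h::real. (max 0 h)\<^sup>2 / h) \<longlongrightarrow> 0) (at 0)"
  proof (rule Lim_null_comparison)
    show "\<forall>\<^sub>F h::real in at 0. norm ((max 0 h)\<^sup>2 / h) \<le> \<bar>h\<bar>"
      by (auto simp: max_def power2_eq_square intro!: always_eventually)
    show "((\<lambda>h::real. \<bar>h\<bar>) \<longlongrightarrow> 0) (at 0)"
      by (auto intro!: tendsto_eq_intros)
  qed
  then show ?thesis
    using True by (simp add: DERIV_def)
next
  case False
  show ?thesis
  proof (cases "t > 0")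
    case True
    have "((\<lambda>t::real. t\<^sup>2) has_real_derivative 2 * max 0 t) (at t)"
      using True by (auto intro!: derivative_eq_intros)
    then show ?thesis
      by (rule has_field_derivative_transform_within_open[of _ _ _ "{0<..}"]) (use True in auto)
  next
    case neg: False
    have "((\<lambda>t::real. 0) has_real_derivative 2 * max 0 t) (at t)"
      using neg by simp
    then show ?thesis
      by (rule has_field_derivative_transform_within_open[of _ _ _ "{..<0}"]) (use neg False in auto)
  qed
qed

lemma has_real_derivative_bump_square:
  "((\<lambda>t. (bump (y + t *\<^sub>R e))\<^sup>2) has_real_derivative
     - 4 * ((y + t *\<^sub>R e) \<bullet> e) * bump (y + t *\<^sub>R e)) (at t)"
proof -
  have "((\<lambda>t. 1 - (y + t *\<^sub>R e) \<bullet> (y + t *\<^sub>R e)) has_real_derivative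
          - 2 * ((y + t *\<^sub>R e) \<bullet> e)) (at t)"
    by (auto intro!: derivative_eq_intros simp: inner_simps algebra_simps inner_commute
        has_real_derivative_iff_has_vector_derivative has_vector_derivative_def)
  from DERIV_chain2[OF has_real_derivative_max_square this]
  show ?thesis
    by (simp add: bump_def algebra_simps)
qed

section \<open>Mean value property of harmonic functions\<close>

lemma C1_function_derivative_along_line:
  fixes f :: "'a::euclidean_space \<Rightarrow> real"
  assumes "C1_function f"
  shows "((\<lambda>t. f (x + t *\<^sub>R v)) has_real_derivative
           (\<Sum>i\<in>Basis. partial_derivative i f (x + t *\<^sub>R v) * (v \<bullet> i))) (at t)"
proof -
  let ?p = "x + t *\<^sub>R v"
  let ?D = "frechet_derivative f (at ?p)"
  have D: "(f has_derivative ?D) (at ?p)"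
    using assms by (simp add: C1_function_def frechet_derivative_works)
  then interpret D: linear ?D
    by (rule has_derivative_linear)
  have "((\<lambda>t. x + t *\<^sub>R v) has_derivative (\<lambda>s. s *\<^sub>R v)) (at t)"
    by (auto intro!: derivative_eq_intros)
  from has_derivative_compose[OF this D]
  have "((\<lambda>t. f (x + t *\<^sub>R v)) has_derivative (\<lambda>s. ?D (s *\<^sub>R v))) (at t)" .
  moreover have "?D (s *\<^sub>R v) = (\<Sum>i\<in>Basis. partial_derivative i f ?p * (v \<bullet> i)) * s" for s
  proof -
    have "?D v = ?D (\<Sum>i\<in>Basis. (v \<bullet> i) *\<^sub>R i)"
      by (simp add: euclidean_representation)
    also have "\<dots> = (\<Sum>i\<in>Basis. partial_derivative i f ?p * (v \<bullet> i))"
      by (simp add: D.sum D.scale partial_derivative_def mult.commute)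
    finally show ?thesis
      by (simp add: D.scale)
  qed
  ultimately show ?thesis
    by (simp add: has_field_derivative_def)
qed

lemma C1_function_continuous_on: "C1_function f \<Longrightarrow> continuous_on UNIV f"
  by (auto simp: C1_function_def intro!: continuous_at_imp_continuous_on differentiable_imp_continuous_within)

text \<open>Up to a constant, \<open>y * bump y\<close> is the gradient of \<open>(bump y)\<^sup>2\<close>, so integration by parts turns the
  integrand into the Laplacian of \<open>f\<close> times \<open>(bump y)\<^sup>2\<close>.\<close>

lemma harmonic_integral_radial_derivative:
  fixes f :: "'a::euclidean_space \<Rightarrow> real"
  assumes "harmonic_function f"
  shows "integral UNIV (\<lambda>y. (\<Sum>i\<in>Basis. partial_derivative i f (x + r *\<^sub>R y) * (y \<bullet> i)) * bump y) = 0"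
proof -
  have C1: "C1_function (partial_derivative i f)" if "i \<in> Basis" for i
    using assms that by (auto simp: harmonic_function_def C2_function_def)
  have lap: "(\<Sum>i\<in>Basis. partial_derivative i (partial_derivative i f) z) = 0" for z
    using assms by (auto simp: harmonic_function_def laplacian_def)
  \<comment> \<open>\<open>A i - 4 * B i\<close> is the derivative in direction \<open>i\<close> of
    the product of \<open>partial_derivative i f (x + r *\<^sub>R y)\<close> and the squared kernel,
    hence has integral 0. Summed over \<open>i\<close>, the \<open>A i\<close> give \<open>r\<close>
    times the Laplacian times the squared kernel, which is 0, so the integrals of the
    \<open>B i\<close> sum to 0 as well.\<close>
  define A where "A i y = r * partial_derivative i (partial_derivative i f) (x + r *\<^sub>R y) * (bump y)\<^sup>2" for i y
  define B where "B i y = partial_derivative i f (x + r *\<^sub>R y) * (y \<bullet> i) * bump y" for i y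
  have contA: "continuous_on UNIV (A i)" and contB: "continuous_on UNIV (B i)" if "i \<in> Basis" for i
    unfolding A_def B_def using C1[OF that] that
    by (auto simp: C1_function_def C1_function_continuous_on[OF C1]
        intro!: continuous_intros continuous_on_affine_compose)
  have intA: "A i integrable_on UNIV" if "i \<in> Basis" for i
    using integrable_UNIV_compact_support[OF contA[OF that]]
      bounded_support_mult_bump[of "\<lambda>y. r * partial_derivative i (partial_derivative i f) (x + r *\<^sub>R y) * bump y"]
    by (simp add: A_def power2_eq_square mult.assoc)
  have intB: "B i integrable_on UNIV" if "i \<in> Basis" for i
    using integrable_UNIV_compact_support[OF contB[OF that]]
      bounded_support_mult_bump[of "\<lambda>y. partial_derivative i f (x + r *\<^sub>R y) * (y \<bullet> i)"]
    by (simp add: B_def)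
  have "integral UNIV (\<lambda>y. A i y - 4 * B i y) = 0" if i: "i \<in> Basis" for i
  proof (rule integral_directional_derivative_eq_0[where e = i
        and g = "\<lambda>y. partial_derivative i f (x + r *\<^sub>R y) * (bump y)\<^sup>2"])
    fix y and t :: real
    have eq: "(x + r *\<^sub>R y) + t *\<^sub>R (r *\<^sub>R i) = x + r *\<^sub>R (y + t *\<^sub>R i)" for t
      by (simp add: algebra_simps)
    have "(\<Sum>j\<in>Basis. partial_derivative j (partial_derivative i f) z * ((r *\<^sub>R i) \<bullet> j))
            = r * partial_derivative i (partial_derivative i f) z" for z
      using i by (subst sum.remove[of _ i]) (auto simp: inner_Basis sum.neutral)
    then have "((\<lambda>t. partial_derivative i f (x + r *\<^sub>R (y + t *\<^sub>R i))) has_real_derivative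
        r * partial_derivative i (partial_derivative i f) (x + r *\<^sub>R (y + t *\<^sub>R i))) (at t)"
      using C1_function_derivative_along_line[OF C1[OF i], of "x + r *\<^sub>R y" "r *\<^sub>R i" t]
      unfolding eq by simp
    from DERIV_mult[OF this has_real_derivative_bump_square]
    show "((\<lambda>t. partial_derivative i f (x + r *\<^sub>R (y + t *\<^sub>R i)) * (bump (y + t *\<^sub>R i))\<^sup>2)
        has_real_derivative A i (y + t *\<^sub>R i) - 4 * B i (y + t *\<^sub>R i)) (at t)"
      by (simp add: A_def B_def algebra_simps)
  next
    show "continuous_on UNIV (\<lambda>y. partial_derivative i f (x + r *\<^sub>R y) * (bump y)\<^sup>2)"
      using C1_function_continuous_on[OF C1[OF i]]
      by (intro continuous_intros continuous_on_affine_compose)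
    show "continuous_on UNIV (\<lambda>y. A i y - 4 * B i y)"
      using contA[OF i] contB[OF i] by (intro continuous_intros)
  qed (auto simp: A_def B_def bump_eq_0)
  then have "(\<Sum>i\<in>Basis. integral UNIV (A i) - 4 * integral UNIV (B i)) = 0"
    using intA intB by (simp add: integral_diff)
  moreover have "(\<Sum>i\<in>Basis. integral UNIV (A i)) = 0"
  proof -
    have "(\<Sum>i\<in>Basis. A i y) = 0" for y
      using lap[of "x + r *\<^sub>R y"]
      by (simp add: A_def flip: sum_distrib_left sum_distrib_right)
    then show ?thesis
      using intA by (simp flip: integral_sum)
  qed
  ultimately have "(\<Sum>i\<in>Basis. integral UNIV (B i)) = 0"
    by (simp add: sum_subtractf flip: sum_distrib_left)
  then have "integral UNIV (\<lambda>y. \<Sum>i\<in>Basis. B i y) = 0"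
    using intB by (simp add: integral_sum)
  then show ?thesis
    by (simp add: B_def sum_distrib_right)
qed

text \<open>Differentiating the weighted mean in the radius gives the integral just shown to vanish.
  The mean is therefore constant in \<open>r\<close>, and at \<open>r = 0\<close> it is
  \<open>f x\<close> times the mass of the kernel.\<close>

lemma harmonic_mean_value:
  fixes f :: "'a::euclidean_space \<Rightarrow> real"
  assumes "harmonic_function f"
  shows "integral UNIV (\<lambda>y. f (x + r *\<^sub>R y) * bump y) = f x * bump_mass TYPE('a)"
proof -
  have C1: "C1_function f"
    using assms by (auto simp: harmonic_function_def C2_function_def)
  note cont = C1_function_continuous_on[OF C1]
  have cont': "continuous_on UNIV (partial_derivative i f)" if "i \<in> Basis" for i
    using C1 that by (auto simp: C1_function_def)
  define F where "F r = integral UNIV (\<lambda>y. f (x + r *\<^sub>R y) * bump y)" for r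
  have "(F has_real_derivative 0) (at r)" for r
  proof -
    have "(F has_real_derivative integral UNIV
        (\<lambda>y. (\<Sum>i\<in>Basis. partial_derivative i f (x + r *\<^sub>R y) * (y \<bullet> i)) * bump y)) (at r)"
      unfolding F_def
    \<comment> \<open>The factor \<open>bump y\<close> confines the support to the unit ball for
      every radius, so any interval having \<open>r\<close> in its interior will do.\<close>
    proof (rule has_real_derivative_integral_UNIV[where A = "\<bar>r\<bar> + 1" and B = 1])
      show "((\<lambda>r. f (x + r *\<^sub>R y) * bump y) has_real_derivative
          (\<Sum>i\<in>Basis. partial_derivative i f (x + r *\<^sub>R y) * (y \<bullet> i)) * bump y) (at r)" for r y
        by (intro DERIV_cmult_right C1_function_derivative_along_line C1)
      show "continuous_on UNIV (\<lambda>y. f (x + r *\<^sub>R y) * bump y)" for r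
        using cont by (intro continuous_intros continuous_on_affine_compose)
      show "continuous_on UNIV (\<lambda>(r, y).
          (\<Sum>i\<in>Basis. partial_derivative i f (x + r *\<^sub>R y) * (y \<bullet> i)) * bump y)"
        unfolding split_beta
        by (intro continuous_intros continuous_on_compose2[OF cont']) auto
    qed (auto simp: bump_eq_0)
    then show ?thesis
      using harmonic_integral_radial_derivative[OF assms] by simp
  qed
  then have "F r = F 0"
    using DERIV_const_ratio_const[of 0 r F 0] by (cases "r = 0") auto
  then show ?thesis
    by (simp add: F_def bump_mass_def)
qed

section \<open>Functions dominated by their means\<close>

text \<open>A weighted form of continuous subharmonicity: the common ground on which convex and
  harmonic functions are treated together until the Liouville theorems.\<close>

definition submean_function :: "('a::euclidean_space \<Rightarrow> real) \<Rightarrow> bool" where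
  "submean_function f \<longleftrightarrow> continuous_on UNIV f \<and>
     (\<forall>x r. f x * bump_mass TYPE('a) \<le> integral UNIV (\<lambda>y. f (x + r *\<^sub>R y) * bump y))"

lemma harmonic_function_continuous_on: "harmonic_function f \<Longrightarrow> continuous_on UNIV f"
  by (auto simp: harmonic_function_def C2_function_def intro: C1_function_continuous_on)

lemma harmonic_imp_submean: "harmonic_function f \<Longrightarrow> submean_function f"
  by (simp add: submean_function_def harmonic_mean_value harmonic_function_continuous_on)

lemma integrable_affine_mult_bump:
  "continuous_on UNIV f \<Longrightarrow> (\<lambda>y. f (x + r *\<^sub>R y) * bump y) integrable_on UNIV"
  by (intro integrable_mult_bump continuous_on_affine_compose)

text \<open>The kernel is even, so the means over \<open>x + r *\<^sub>R y\<close> and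
  \<open>x - r *\<^sub>R y\<close> agree. Midpoint convexity bounds \<open>2 * f x\<close> by the
  sum of the two values, and integration gives the claim.\<close>

lemma convex_imp_submean:
  fixes f :: "'a::euclidean_space \<Rightarrow> real"
  assumes "convex_on UNIV f"
  shows "submean_function f"
  unfolding submean_function_def
proof (intro conjI allI)
  show cont: "continuous_on UNIV f"
    using assms convex_on_continuous by blast
  fix x :: 'a and r :: real
  let ?g = "\<lambda>y. f (x + r *\<^sub>R y) * bump y" and ?h = "\<lambda>y. f (x + (-r) *\<^sub>R y) * bump y"
  note int = integrable_affine_mult_bump[OF cont]
  have "((\<lambda>y. ?g (0 + (-1) *\<^sub>R y)) has_integral integral UNIV ?g / \<bar>-1\<bar> ^ DIM('a)) UNIV"
    by (rule has_integral_affinity_UNIV[OF integrable_integral[OF int] bounded_support_mult_bump]) simp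
  then have "integral UNIV ?h = integral UNIV ?g"
    by (intro integral_unique) (simp add: bump_def)
  moreover have "integral UNIV (\<lambda>y::'a. 2 * f x * bump y) \<le> integral UNIV (\<lambda>y. ?g y + ?h y)"
  proof (rule integral_le)
    show "(\<lambda>y::'a. 2 * f x * bump y) integrable_on UNIV"
      by (intro integrable_mult_bump continuous_intros)
    show "(\<lambda>y. ?g y + ?h y) integrable_on UNIV"
      by (intro integrable_add int)
    fix y :: 'a
    have "f ((1 - 1/2) *\<^sub>R (x + r *\<^sub>R y) + (1/2) *\<^sub>R (x + (-r) *\<^sub>R y))
            \<le> (1 - 1/2) * f (x + r *\<^sub>R y) + (1/2) * f (x + (-r) *\<^sub>R y)"
      by (rule convex_onD[OF assms]) auto
    moreover have "(1 - 1/2) *\<^sub>R (x + r *\<^sub>R y) + (1/2) *\<^sub>R (x + (-r) *\<^sub>R y) = x"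
      by (simp add: scaleR_right_distrib scaleR_right_diff_distrib scaleR_half_double flip: scaleR_left_distrib)
    ultimately have "2 * f x \<le> f (x + r *\<^sub>R y) + f (x + (-r) *\<^sub>R y)"
      by simp
    then have "2 * f x * bump y \<le> (f (x + r *\<^sub>R y) + f (x + (-r) *\<^sub>R y)) * bump y"
      by (intro mult_right_mono bump_nonneg)
    then show "2 * f x * bump y \<le> ?g y + ?h y"
      by (simp only: distrib_right)
  qed
  ultimately show "f x * bump_mass TYPE('a) \<le> integral UNIV ?g"
    using int[of x r] int[of x "-r"] by (simp add: integral_add bump_mass_def)
qed

section \<open>Upper bounds across a set of zero density\<close>

text \<open>Average \<open>f - C\<close> around \<open>x\<close> at scale \<open>r\<close>; the
  region of averaging lies in \<open>ball 0 (2 * r)\<close> since \<open>norm x \<le> r\<close>.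
  Points off \<open>E\<close> contribute at most 0 and points of \<open>E\<close> at most
  \<open>A\<close>, because \<open>bump\<close> is at most 1. The power of \<open>r\<close> in the
  denominator comes from the change of variables.\<close>

lemma submean_bound:
  fixes f :: "'a::euclidean_space \<Rightarrow> real"
  assumes "submean_function f" and E: "E \<in> sets lebesgue"
    and off: "\<And>z. z \<notin> E \<Longrightarrow> f z \<le> C"
    and on: "\<And>z. z \<in> ball 0 (2 * r) \<Longrightarrow> f z \<le> C + A"
    and "A \<ge> 0" "r > 0" "norm x \<le> r"
  shows "(f x - C) * bump_mass TYPE('a) \<le> A * (measure lebesgue (E \<inter> ball 0 (2 * r)) / r ^ DIM('a))"
proof -
  have cont: "continuous_on UNIV f"
    and sub: "f x * bump_mass TYPE('a) \<le> integral UNIV (\<lambda>y. f (x + r *\<^sub>R y) * bump y)"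
    using assms(1) by (auto simp: submean_function_def)
  define S where "S = E \<inter> ball 0 (2 * r)"
  have "S \<in> lmeasurable"
    unfolding S_def using E by (subst Int_commute) (intro fmeasurable_Int_fmeasurable lmeasurable_ball)
  then have "(indicator S has_integral measure lebesgue S) UNIV"
    by (simp add: lmeasurable_iff_has_integral)
  moreover have "bounded {z. (indicator S z :: real) \<noteq> 0}"
    by (rule bounded_subset[OF bounded_ball[of 0 "2 * r"]]) (auto simp: S_def indicator_def)
  ultimately have "((\<lambda>y. indicator S (x + r *\<^sub>R y)) has_integral measure lebesgue S / \<bar>r\<bar> ^ DIM('a)) UNIV"
    by (rule has_integral_affinity_UNIV) (use \<open>r > 0\<close> in simp)
  then have S: "((\<lambda>y. A * indicator S (x + r *\<^sub>R y)) has_integral A * (measure lebesgue S / r ^ DIM('a))) UNIV"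
    using \<open>r > 0\<close> by (intro has_integral_mult_right) simp
  have "((\<lambda>y. f (x + r *\<^sub>R y) * bump y - C * bump y) has_integral
      integral UNIV (\<lambda>y. f (x + r *\<^sub>R y) * bump y) - C * bump_mass TYPE('a)) UNIV"
    unfolding bump_mass_def
    by (intro has_integral_diff has_integral_mult_right integrable_integral
        integrable_affine_mult_bump cont integrable_bump)
  then have "integral UNIV (\<lambda>y. f (x + r *\<^sub>R y) * bump y) - C * bump_mass TYPE('a)
      \<le> A * (measure lebesgue S / r ^ DIM('a))"
  proof (rule has_integral_le[OF _ S])
    fix y :: 'a
    have "(f (x + r *\<^sub>R y) - C) * bump y \<le> A * indicator S (x + r *\<^sub>R y)"
    proof (cases "norm y < 1")
      case True
      have "norm (x + r *\<^sub>R y) \<le> norm x + r * norm y"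
        using \<open>r > 0\<close> norm_triangle_ineq[of x "r *\<^sub>R y"] by simp
      also have "\<dots> < 2 * r"
        using True assms(6,7) mult_strict_left_mono[OF True \<open>r > 0\<close>] by linarith
      finally have ball: "x + r *\<^sub>R y \<in> ball 0 (2 * r)"
        by simp
      show ?thesis
      proof (cases "x + r *\<^sub>R y \<in> E")
        case True
        have "(f (x + r *\<^sub>R y) - C) * bump y \<le> A * bump y"
          using on[OF ball] by (intro mult_right_mono bump_nonneg) simp
        also have "\<dots> \<le> A * 1"
          using \<open>A \<ge> 0\<close> by (intro mult_left_mono bump_le_1)
        finally show ?thesis
          using True ball by (simp add: S_def)
      next
        case False
        have "(f (x + r *\<^sub>R y) - C) * bump y \<le> 0"
          using off[OF False] bump_nonneg by (intro mult_nonpos_nonneg) auto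
        then show ?thesis
          using False by (simp add: S_def)
      qed
    qed (use \<open>A \<ge> 0\<close> in \<open>simp add: bump_eq_0\<close>)
    then show "f (x + r *\<^sub>R y) * bump y - C * bump y \<le> A * indicator S (x + r *\<^sub>R y)"
      by (simp add: left_diff_distrib)
  qed
  then show ?thesis
    using sub by (simp add: S_def left_diff_distrib)
qed

text \<open>An order below some natural number \<open>p\<close> gives
  \<open>1 + max 0 (f z) < norm z ^ p\<close> for large \<open>norm z\<close> by exponentiating; the
  remaining ball is compact, so continuity bounds \<open>f\<close> there.\<close>

lemma finite_order_polynomial_growth:
  fixes f :: "'a::euclidean_space \<Rightarrow> real"
  assumes "finite_order f" and cont: "continuous_on UNIV f"
  obtains K p where "K \<ge> 0" "\<And>s z. s \<ge> 1 \<Longrightarrow> norm z \<le> s \<Longrightarrow> f z \<le> K * s ^ p"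
proof -
  have "function_order f \<noteq> \<infinity>"
    using assms(1) by (simp add: finite_order_def)
  then obtain p :: nat where "function_order f < ereal (real p)"
    using less_PInf_Ex_of_nat by auto
  then have "\<forall>\<^sub>F x in at_infinity. ereal (ln (1 + max 0 (f x)) / ln (norm x)) < ereal (real p)"
    unfolding function_order_def by (rule Limsup_lessD)
  then obtain b where b: "\<And>x. norm x \<ge> b \<Longrightarrow> ln (1 + max 0 (f x)) / ln (norm x) < real p"
    by (auto simp: eventually_at_infinity)
  \<comment> \<open>The 2 ensures \<open>norm z > 1\<close> outside the ball, so
    \<open>ln (norm z)\<close> is positive and the quotient can be cleared.\<close>
  define R where "R = max b 2"
  have "compact (f ` cball 0 R)"
    by (rule compact_continuous_image[OF continuous_on_subset[OF cont]]) auto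
  then have "bounded (f ` cball 0 R)"
    by (rule compact_imp_bounded)
  then obtain K where "\<forall>z\<in>cball 0 R. \<bar>f z\<bar> \<le> K"
    by (auto simp: bounded_iff)
  then have K: "\<bar>f z\<bar> \<le> K" if "norm z \<le> R" for z
    using that by simp
  have K0: "K \<ge> 0"
  proof -
    have "norm (0::'a) \<le> R"
      by (simp add: R_def)
    then show ?thesis
      using K[of 0] by linarith
  qed
  show thesis
  proof
    \<comment> \<open>The constant \<open>K + 1\<close> covers both regions: \<open>K\<close> inside
      the ball, 1 outside it.\<close>
    show "K + 1 \<ge> 0"
      using K0 by simp
    fix s :: real and z :: 'a assume s: "s \<ge> 1" "norm z \<le> s"
    have sp: "s ^ p \<ge> 1"
      using s by simp
    show "f z \<le> (K + 1) * s ^ p"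
    proof (cases "norm z \<le> R")
      case True
      then have "f z \<le> (K + 1) * 1"
        using K[of z] by simp
      also have "\<dots> \<le> (K + 1) * s ^ p"
        using sp K0 by (intro mult_left_mono) auto
      finally show ?thesis .
    next
      case False
      then have z: "norm z \<ge> b" "norm z > 1"
        by (auto simp: R_def)
      have "ln (1 + max 0 (f z)) < real p * ln (norm z)"
        using b[OF z(1)] ln_gt_zero[OF z(2)] by (simp only: pos_divide_less_eq)
      also have "\<dots> = ln (norm z ^ p)"
        using z by (simp add: ln_realpow)
      finally have "1 + max 0 (f z) < norm z ^ p"
        using z by (subst (asm) ln_less_cancel_iff) (auto intro!: zero_less_power simp del: zero_less_norm_iff)
      also have "\<dots> \<le> s ^ p"
        using s by (intro power_mono) auto
      finally have "f z \<le> 1 * s ^ p"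
        by simp
      also have "\<dots> \<le> (K + 1) * s ^ p"
        using sp K0 by (intro mult_right_mono) auto
      finally show ?thesis .
    qed
  qed
qed

text \<open>The excess of \<open>f x\<close> over \<open>C\<close> is bounded by a constant times
  \<open>(1 / 2) ^ k\<close> for every \<open>k\<close>, where the constant depends on
  \<open>x\<close> but not on \<open>k\<close>.\<close>

lemma submean_le_of_zero_density:
  fixes f :: "'a::euclidean_space \<Rightarrow> real"
  assumes sub: "submean_function f" and "finite_order f" and E: "has_relative_density E 0"
    and off: "\<And>z. z \<notin> E \<Longrightarrow> f z \<le> C"
  shows "f x \<le> C"
proof -
  let ?n = "DIM('a)" and ?m = "bump_mass TYPE('a)"
  obtain K p where K: "K \<ge> 0" "\<And>s z. s \<ge> 1 \<Longrightarrow> norm z \<le> s \<Longrightarrow> f z \<le> K * s ^ p"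
    using finite_order_polynomial_growth[OF assms(2)] sub by (auto simp: submean_function_def)
  \<comment> \<open>The growth bound is recentred at \<open>C\<close>: since
    \<open>s ^ p \<ge> 1\<close>, the term \<open>\<bar>C\<bar> * s ^ p\<close> absorbs
    \<open>- C\<close> whatever the sign of \<open>C\<close>.\<close>
  define K' where "K' = K + \<bar>C\<bar>"
  have K': "K' \<ge> 0" "f z \<le> C + K' * s ^ p" if "s \<ge> 1" "norm z \<le> s" for s z
  proof -
    have "- C \<le> \<bar>C\<bar> * s ^ p"
      using mult_left_mono[of 1 "s ^ p" "\<bar>C\<bar>"] that by simp
    then show "f z \<le> C + K' * s ^ p"
      using K(2)[OF that] by (simp add: K'_def distrib_right)
  qed (use K in \<open>simp add: K'_def\<close>)
  \<comment> \<open>Each doubling of the radius costs a factor \<open>2 ^ p\<close> in the growth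
    bound; this choice leaves a net factor of 1/2.\<close>
  define \<epsilon> :: real where "\<epsilon> = 1 / 2 ^ Suc p"
  have "\<epsilon> > 0"
    by (simp add: \<epsilon>_def)
  have Em: "E \<in> sets lebesgue"
    and lim: "((\<lambda>r. measure lebesgue (E \<inter> ball 0 r) / r ^ ?n) \<longlongrightarrow> 0) at_top"
    using E by (auto simp: has_relative_density_def)
  \<comment> \<open>The divisor \<open>2 ^ ?n\<close> compensates for measuring \<open>E\<close> in
    the ball of radius \<open>2 * r\<close> relative to \<open>r ^ ?n\<close>.\<close>
  have "\<epsilon> * ?m / 2 ^ ?n > 0"
    using \<open>\<epsilon> > 0\<close> bump_mass_pos[where 'a = 'a] by simp
  from order_tendstoD(2)[OF lim this]
  obtain r0 where r0: "\<And>s. s \<ge> r0 \<Longrightarrow> measure lebesgue (E \<inter> ball 0 s) / s ^ ?n < \<epsilon> * ?m / 2 ^ ?n"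
    by (auto simp: eventually_at_top_linorder)
  have step: "f z \<le> C + \<epsilon> * A"
    if r: "r \<ge> max 1 r0" and A: "A \<ge> 0" "\<And>z. z \<in> ball 0 (2 * r) \<Longrightarrow> f z \<le> C + A" and z: "z \<in> ball 0 r"
    for r A z
  proof -
    have "r > 0"
      using r by simp
    have "(f z - C) * ?m \<le> A * (measure lebesgue (E \<inter> ball 0 (2 * r)) / r ^ ?n)"
      by (rule submean_bound[OF sub Em off A(2) A(1) \<open>r > 0\<close>]) (use z in auto)
    also have "measure lebesgue (E \<inter> ball 0 (2 * r)) / r ^ ?n
        = 2 ^ ?n * (measure lebesgue (E \<inter> ball 0 (2 * r)) / (2 * r) ^ ?n)"
      by (simp add: power_mult_distrib)
    also have "A * \<dots> \<le> A * (2 ^ ?n * (\<epsilon> * ?m / 2 ^ ?n))"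
      using r A by (intro mult_left_mono less_imp_le[OF r0]) auto
    also have "\<dots> = (\<epsilon> * A) * ?m"
      by simp
    finally show ?thesis
      using bump_mass_pos[where 'a = 'a] by simp
  qed
  have iter: "f z \<le> C + \<epsilon> ^ k * A"
    if "r \<ge> max 1 r0" "A \<ge> 0" "\<And>z. z \<in> ball 0 (2 ^ k * r) \<Longrightarrow> f z \<le> C + A" "z \<in> ball 0 r"
    for k r A z
    using that
  proof (induction k arbitrary: A z)
    case (Suc k)
    \<comment> \<open>The outermost scale is contracted first, from radius
      \<open>2 ^ Suc k * r\<close> to \<open>2 ^ k * r\<close>; the induction hypothesis then takes
      over with \<open>\<epsilon> * A\<close> in place of \<open>A\<close>.\<close>
    have "f w \<le> C + \<epsilon> * A" if w: "w \<in> ball 0 (2 ^ k * r)" for w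
    proof (rule step[OF _ Suc.prems(2) _ w])
      have "1 * r \<le> 2 ^ k * r"
        using Suc.prems(1) by (intro mult_right_mono) auto
      then show "max 1 r0 \<le> 2 ^ k * r"
        using Suc.prems(1) by linarith
      show "f v \<le> C + A" if "v \<in> ball 0 (2 * (2 ^ k * r))" for v
        using Suc.prems(3)[of v] that by (simp add: mult.assoc)
    qed
    then have "f z \<le> C + \<epsilon> ^ k * (\<epsilon> * A)"
      using Suc.prems \<open>\<epsilon> > 0\<close> by (intro Suc.IH) auto
    then show ?case
      by (simp add: mult.assoc mult.left_commute)
  qed simp
  define r where "r = max (max 1 r0) (norm x + 1)"
  have r: "r \<ge> max 1 r0" "r \<ge> 1" "x \<in> ball 0 r"
    by (auto simp: r_def)
  have bound: "f x \<le> C + K' * r ^ p * (1 / 2) ^ k" for k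
  proof -
    have s: "2 ^ k * r \<ge> 1"
      using mult_mono[of 1 "2 ^ k" 1 r] r by simp
    \<comment> \<open>The initial excess \<open>A\<close> is the polynomial bound on the largest
      ball, of radius \<open>2 ^ k * r\<close>.\<close>
    have "f x \<le> C + \<epsilon> ^ k * (K' * (2 ^ k * r) ^ p)"
      by (rule iter[OF r(1) _ _ r(3)]) (use K'(2)[OF s] K'(1)[OF s, of 0] r in auto)
    also have "\<epsilon> ^ k * (K' * (2 ^ k * r) ^ p) = K' * r ^ p * (1 / 2) ^ k"
    proof -
      have "((2::real) ^ k) ^ p = (2 ^ p) ^ k"
        by (simp add: mult.commute flip: power_mult)
      then have "\<epsilon> ^ k * (K' * (2 ^ k * r) ^ p) = K' * r ^ p * (\<epsilon> * 2 ^ p) ^ k"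
        by (simp only: power_mult_distrib mult_ac)
      then show ?thesis
        by (simp add: \<epsilon>_def)
    qed
    finally show ?thesis .
  qed
  have "(\<lambda>k. C + K' * r ^ p * (1 / 2) ^ k) \<longlonglongrightarrow> C + K' * r ^ p * 0"
    by (intro tendsto_intros LIMSEQ_power_zero) auto
  then show ?thesis
    using LIMSEQ_le_const[of _ C "f x"] bound by auto
qed

section \<open>Liouville theorems\<close>

text \<open>The point \<open>y\<close> lies on the segment from \<open>x\<close> to the distant
  point \<open>x + real (Suc n) *\<^sub>R (y - x)\<close>, whose weight
  \<open>1 / real (Suc n)\<close> tends to 0 while its value stays below \<open>C\<close>. In the
  limit \<open>f y \<le> f x\<close>, and the roles can be exchanged.\<close>

lemma convex_bounded_above_constant:
  fixes f :: "'a::real_vector \<Rightarrow> real"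
  assumes "convex_on UNIV f" and bound: "\<And>x. f x \<le> C"
  shows "f x = f y"
proof -
  have "f y \<le> f x" for x y
  proof -
    have "f y \<le> f x + (C - f x) / real (Suc n)" for n
    proof -
      let ?t = "1 / real (Suc n)"
      have "f ((1 - ?t) *\<^sub>R x + ?t *\<^sub>R (x + real (Suc n) *\<^sub>R (y - x)))
          \<le> (1 - ?t) * f x + ?t * f (x + real (Suc n) *\<^sub>R (y - x))"
        by (rule convex_onD[OF assms(1)]) auto
      also have "(1 - ?t) *\<^sub>R x + ?t *\<^sub>R (x + real (Suc n) *\<^sub>R (y - x)) = y"
        by (simp add: scaleR_right_distrib scaleR_left_diff_distrib del: of_nat_Suc)
      also have "(1 - ?t) * f x + ?t * f (x + real (Suc n) *\<^sub>R (y - x)) \<le> (1 - ?t) * f x + ?t * C"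
        by (intro add_left_mono mult_left_mono bound) auto
      also have "(1 - ?t) * f x + ?t * C = f x + (C - f x) / real (Suc n)"
        by (simp add: left_diff_distrib diff_divide_distrib del: of_nat_Suc)
      finally show ?thesis .
    qed
    moreover have "(\<lambda>n. f x + (C - f x) / real (Suc n)) \<longlonglongrightarrow> f x + 0"
      by (intro tendsto_intros LIMSEQ_Suc[OF lim_const_over_n])
    ultimately show ?thesis
      using LIMSEQ_le_const[of _ "f x" "f y"] by auto
  qed
  then show ?thesis
    by (simp add: antisym)
qed

section \<open>Harnack inequality and Liouville theorem for harmonic functions\<close>

text \<open>The mean value property in the coordinate \<open>z = x + R *\<^sub>R y\<close>, so that
  means with different centres and radii become integrals of the same function \<open>C - f\<close>
  and only the kernels need comparing.\<close>

lemma harmonic_mean_value_rescaled: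
  fixes f :: "'a::euclidean_space \<Rightarrow> real"
  assumes "harmonic_function f" and R: "R > 0"
  shows "((\<lambda>z. (C - f z) * bump ((1 / R) *\<^sub>R (z - x))) has_integral
           (C - f x) * bump_mass TYPE('a) * R ^ DIM('a)) UNIV"
proof -
  note cont = harmonic_function_continuous_on[OF assms(1)]
  let ?g = "\<lambda>y. C * bump y - f (x + R *\<^sub>R y) * bump y"
  have "(?g has_integral C * bump_mass TYPE('a) - integral UNIV (\<lambda>y. f (x + R *\<^sub>R y) * bump y)) UNIV"
    unfolding bump_mass_def
    by (intro has_integral_diff has_integral_mult_right integrable_integral
        integrable_affine_mult_bump cont integrable_bump)
  then have int: "(?g has_integral C * bump_mass TYPE('a) - f x * bump_mass TYPE('a)) UNIV"
    by (simp only: harmonic_mean_value[OF assms(1)])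
  have supp: "bounded {y. ?g y \<noteq> 0}"
    using bounded_support_mult_bump[of "\<lambda>y. C - f (x + R *\<^sub>R y)"] by (simp add: left_diff_distrib)
  have "((\<lambda>z. ?g (- ((1 / R) *\<^sub>R x) + (1 / R) *\<^sub>R z)) has_integral
      (C * bump_mass TYPE('a) - f x * bump_mass TYPE('a)) / \<bar>1 / R\<bar> ^ DIM('a)) UNIV"
    by (rule has_integral_affinity_UNIV[OF int supp]) (use R in simp)
  moreover have "- ((1 / R) *\<^sub>R x) + (1 / R) *\<^sub>R z = (1 / R) *\<^sub>R (z - x)" for z
    by (simp add: scaleR_right_diff_distrib)
  ultimately show ?thesis
    using R by (simp add: left_diff_distrib power_divide)
qed

text \<open>The factor \<open>R\<^sup>2\<close> clears the denominators, leaving paraboloids that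
  differ only in height and centre.\<close>

lemma bump_scaled:
  assumes "R > 0"
  shows "R\<^sup>2 * bump ((1 / R) *\<^sub>R w) = max 0 (R\<^sup>2 - (norm w)\<^sup>2)"
proof -
  have "R\<^sup>2 * bump ((1 / R) *\<^sub>R w) = max 0 (R\<^sup>2 * (1 - (norm ((1 / R) *\<^sub>R w))\<^sup>2))"
    using assms by (simp only: bump_def dot_square_norm max_mult_distrib_left) simp
  also have "R\<^sup>2 * (1 - (norm ((1 / R) *\<^sub>R w))\<^sup>2) = R\<^sup>2 - (norm w)\<^sup>2"
    using assms by (simp add: right_diff_distrib power_divide)
  finally show ?thesis .
qed

text \<open>Domination of the kernel centred at \<open>x\<close> by a slightly wider one centred at \<open>y\<close>: with the mean
  value property it yields a Harnack inequality.\<close>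

lemma bump_scaled_mono:
  assumes "R > 0"
  shows "R\<^sup>2 * bump ((1 / R) *\<^sub>R (z - x))
    \<le> (R + norm (x - y))\<^sup>2 * bump ((1 / (R + norm (x - y))) *\<^sub>R (z - y))"
proof -
  let ?d = "norm (x - y)" and ?s = "norm (z - x)" and ?t = "norm (z - y)"
  have t: "?t \<le> ?s + ?d"
    using norm_triangle_ineq[of "z - x" "x - y"] by simp
  have "max 0 (R\<^sup>2 - ?s\<^sup>2) \<le> max 0 ((R + ?d)\<^sup>2 - ?t\<^sup>2)"
  proof (cases "?s \<le> R")
    case True
    have "?t\<^sup>2 \<le> (?s + ?d)\<^sup>2"
      using t by (intro power_mono) auto
    \<comment> \<open>Once both squares are expanded, only the cross terms remain to be
      compared.\<close>
    moreover have "?d * ?s \<le> ?d * R"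
      using True by (intro mult_left_mono) auto
    ultimately have "R\<^sup>2 - ?s\<^sup>2 \<le> (R + ?d)\<^sup>2 - ?t\<^sup>2"
      by (simp add: power2_sum algebra_simps)
    then show ?thesis
      by (simp add: max_def)
  next
    case False
    then have "R\<^sup>2 \<le> ?s\<^sup>2"
      using assms by (intro power_mono) auto
    then show ?thesis
      by simp
  qed
  moreover have "R + ?d > 0"
    using assms by (simp add: add_pos_nonneg)
  ultimately show ?thesis
    using assms by (simp only: bump_scaled)
qed

text \<open>Integrating the kernel comparison against the nonnegative function \<open>C - f\<close>
  bounds \<open>C - f x\<close> by \<open>C - f y\<close> times a power of
  \<open>1 + ?d / R\<close>. This factor tends to 1 as \<open>R\<close> grows, and exchanging
  \<open>x\<close> and \<open>y\<close> gives equality.\<close>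

lemma harmonic_bounded_above_constant:
  fixes f :: "'a::euclidean_space \<Rightarrow> real"
  assumes harm: "harmonic_function f" and bound: "\<And>x. f x \<le> C"
  shows "f x = f y"
proof -
  have "C - f x \<le> C - f y" for x y
  proof -
    let ?d = "norm (x - y)" and ?m = "bump_mass TYPE('a)" and ?n = "DIM('a)"
    have "C - f x \<le> (C - f y) * (1 + ?d / real (Suc k)) ^ (?n + 2)" for k
    proof -
      define R where "R = real (Suc k)"
      have R: "R > 0" "R + ?d > 0"
        by (auto simp: R_def add_pos_nonneg)
      have "R\<^sup>2 * ((C - f x) * ?m * R ^ ?n) \<le> (R + ?d)\<^sup>2 * ((C - f y) * ?m * (R + ?d) ^ ?n)"
      proof (rule has_integral_le)
        show "((\<lambda>z. R\<^sup>2 * ((C - f z) * bump ((1 / R) *\<^sub>R (z - x)))) has_integral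
            R\<^sup>2 * ((C - f x) * ?m * R ^ ?n)) UNIV"
          by (intro has_integral_mult_right harmonic_mean_value_rescaled harm R)
        show "((\<lambda>z. (R + ?d)\<^sup>2 * ((C - f z) * bump ((1 / (R + ?d)) *\<^sub>R (z - y)))) has_integral
            (R + ?d)\<^sup>2 * ((C - f y) * ?m * (R + ?d) ^ ?n)) UNIV"
          by (intro has_integral_mult_right harmonic_mean_value_rescaled harm R)
        fix z
        show "R\<^sup>2 * ((C - f z) * bump ((1 / R) *\<^sub>R (z - x)))
            \<le> (R + ?d)\<^sup>2 * ((C - f z) * bump ((1 / (R + ?d)) *\<^sub>R (z - y)))"
          using mult_left_mono[OF bump_scaled_mono[OF R(1), of z x y], of "C - f z"] bound[of z]
          by (simp only: mult.left_commute[of _ "C - f z"])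
      qed
      \<comment> \<open>In the exponent, \<open>?n\<close> comes from the change of variables and 2
        from the normalisation of the kernels.\<close>
      then have "((C - f x) * R ^ (?n + 2)) * ?m \<le> ((C - f y) * (R + ?d) ^ (?n + 2)) * ?m"
        by (simp only: power_add mult_ac)
      then have "(C - f x) * R ^ (?n + 2) \<le> (C - f y) * (R + ?d) ^ (?n + 2)"
        using bump_mass_pos[where 'a = 'a] by (simp only: mult_le_cancel_right_pos)
      then have "C - f x \<le> (C - f y) * ((R + ?d) ^ (?n + 2) / R ^ (?n + 2))"
        using R by (simp add: pos_le_divide_eq del: power_add power_Suc add_2_eq_Suc')
      also have "(R + ?d) ^ (?n + 2) / R ^ (?n + 2) = (1 + ?d / R) ^ (?n + 2)"
        using R by (simp add: add_divide_distrib flip: power_divide del: add_2_eq_Suc')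
      finally show ?thesis
        by (simp only: R_def)
    qed
    moreover have "(\<lambda>k. (C - f y) * (1 + ?d / real (Suc k)) ^ (?n + 2)) \<longlonglongrightarrow> (C - f y) * (1 + 0) ^ (?n + 2)"
      by (intro tendsto_intros LIMSEQ_Suc[OF lim_const_over_n])
    ultimately show ?thesis
      using LIMSEQ_le_const[of _ "C - f y" "C - f x"] by auto
  qed
  from this[of x y] this[of y x] show ?thesis
    by simp
qed

theorem mainTheorem3:
  fixes E :: "(real ^ 'm) set" and f :: "real ^ 'm \<Rightarrow> real"
  assumes "has_relative_density E 0"
    and "convex_on UNIV f \<or> harmonic_function f"
    and "finite_order f"
    and "bdd_above (f ` (UNIV - E))"
  shows "f constant_on UNIV"
proof -
  obtain C where C: "\<And>z. z \<notin> E \<Longrightarrow> f z \<le> C"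
    using assms(4) by (auto simp: bdd_above_def)
  have "submean_function f"
    using assms(2) convex_imp_submean harmonic_imp_submean by blast
  then have "f x \<le> C" for x
    using submean_le_of_zero_density assms(1,3) C by blast
  then have "f x = f 0" for x
    using assms(2) convex_bounded_above_constant harmonic_bounded_above_constant by blast
  then show ?thesis
    by (auto simp: constant_on_def)
qed

end
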